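(* Let $(M,d)$ be an ultrametric space and let $A,B\subseteq M$ be nonempty proximinal subsets of $M$, with $B$ bounded. Assume that $\delta(B)\le \mathrm{dist}(A,B)$. Then $A_0\neq\varnothing$ and $B_0=B$.
   Context: An ultrametric space is a metric space $(M,d)$ with $d(x,y)\le\max\{d(x,z),d(z,y)\}$ for all $x,y,z\in M$. A subset $A\subseteq M$ is proximinal (in $M$) if for every $x\in M$ there is $a_0\in A$ with $d(x,a_0)=\mathrm{dist}(x,A)=\inf\{d(x,z): z\in A\}$. For a bounded set $B$, $\delta(B)=\sup\{d(x,y): x,y\in B\}$ is its diameter. For nonempty $A,B\subseteq M$, $\mathrm{dist}(A,B)=\inf\{d(a,b): a\in A,\ b\in B\}$, and $$A_0=\{x\in A: d(x,y)=\mathrm{dist}(A,B)\text{ for some }y\in B\},\qquad B_0=\{y\in B: d(x,y)=\mathrm{dist}(A,B)\text{ for some }x\in A\}.$$ A pair $(A,B)$ is said to be proximinal if both $A$ and $B$ are. *)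

theory Defs
  imports "HOL-Analysis.Analysis"
begin

class ultrametric_space = metric_space +
  assumes dist_ultrametric: "dist x y \<le> max (dist x z) (dist z y)"

definition proximinal :: "'a::metric_space set \<Rightarrow> bool" where
  "proximinal A \<longleftrightarrow> (\<forall>x. \<exists>a\<^sub>0\<in>A. dist x a\<^sub>0 = infdist x A)"

(* A_0 and B_0 for the pair (A, B) *)
definition best_prox_left :: "'a::metric_space set \<Rightarrow> 'a set \<Rightarrow> 'a set" where
  "best_prox_left A B = {x \<in> A. \<exists>y\<in>B. dist x y = setdist A B}"

definition best_prox_right :: "'a::metric_space set \<Rightarrow> 'a set \<Rightarrow> 'a set" where
  "best_prox_right A B = {y \<in> B. \<exists>x\<in>A. dist x y = setdist A B}"

end

theory Submission
  imports Defs
begin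

(* Since the diameter of B is at most dist(A, B), the ultrametric inequality makes d(a, b)
   independent of b in B for each a in A. Hence every b in B satisfies
   dist(b, A) = dist(A, B), and proximinality of A provides a point where this is attained. *)

text \<open>In the ultrametric bound of \<open>dist a b\<close> through \<open>b'\<close>, the term
  \<open>dist b' b\<close> is absorbed: it is at most \<open>diameter B\<close>, hence at most
  \<open>dist a b'\<close>. Swapping \<open>b\<close> and \<open>b'\<close> gives equality.\<close>

lemma dist_le_dist_if_diameter_le_setdist:
  fixes A B :: "'a::ultrametric_space set"
  assumes "bounded B" "diameter B \<le> setdist A B" "a \<in> A" "b \<in> B" "b' \<in> B"
  shows "dist a b \<le> dist a b'"
proof -
  have "dist b' b \<le> diameter B"
    using assms by (intro diameter_bounded_bound)
  also have "\<dots> \<le> dist a b'"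
    using assms setdist_le_dist order_trans by blast
  finally show ?thesis
    using dist_ultrametric[of a b b'] by simp
qed

lemma infdist_eq_setdist_if_diameter_le_setdist:
  fixes A B :: "'a::ultrametric_space set"
  assumes "A \<noteq> {}" "bounded B" "diameter B \<le> setdist A B" "b \<in> B"
  shows "infdist b A = setdist A B"
proof (rule antisym)
  show "infdist b A \<le> setdist A B"
  proof (rule le_setdistI)
    fix a b' assume "a \<in> A" "b' \<in> B"
    then have "infdist b A \<le> dist a b"
      by (metis dist_commute infdist_le)
    \<comment> \<open>Moving the second point of any competing pair to the fixed \<open>b\<close>
      costs nothing.\<close>
    also have "\<dots> \<le> dist a b'"
      using assms \<open>a \<in> A\<close> \<open>b' \<in> B\<close> by (intro dist_le_dist_if_diameter_le_setdist)
    finally show "infdist b A \<le> dist a b'" .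
  qed (use assms in auto)
  show "setdist A B \<le> infdist b A"
    unfolding infdist_notempty[OF \<open>A \<noteq> {}\<close>]
    using assms by (intro cINF_greatest) (auto simp: dist_commute setdist_le_dist)
qed

theorem lemma2p1:
  fixes A B :: "'a::ultrametric_space set"
  assumes "A \<noteq> {}" and "B \<noteq> {}"
    and "proximinal A" and "proximinal B"
    and "bounded B"
    and "diameter B \<le> setdist A B"
  shows "best_prox_left A B \<noteq> {} \<and> best_prox_right A B = B"
proof -
  have "\<exists>a\<in>A. dist a b = setdist A B" if "b \<in> B" for b
    using assms that infdist_eq_setdist_if_diameter_le_setdist[of A B b]
    unfolding proximinal_def by (metis dist_commute)
  \<comment> \<open>The point \<open>a\<close> found for any single \<open>b\<close> already lies in
    \<open>best_prox_left A B\<close>.\<close>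
  with \<open>B \<noteq> {}\<close> show ?thesis
    unfolding best_prox_left_def best_prox_right_def by blast
qed

end
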